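(* Let $\mathbb{K}$ be a field (usually $\mathbb{R}$ or $\mathbb{C}$). If $C\in(\mathbb{K}^m)^{\otimes k}$ has trivial stabilizer under congruence, then rank $m$ matrices $X\in\mathbb{K}^{d\times m}$ are identifiable from the signature tensor $[\![C;X,X,\ldots,X]\!]$, i.e. such an $X$ can be recovered from $[\![C;X,X,\ldots,X]\!]$ up to scale.
   Context: For a tensor $C=(c_{\alpha_1\ldots\alpha_k}) \in (\mathbb{K}^m)^{\otimes k}$ and a matrix $X=(x_{ij}) \in \mathbb{K}^{d\times m}$, the tensor $[\![C;X,\ldots,X]\!] \in (\mathbb{K}^d)^{\otimes k}$ has entries $$[\![C;X,\ldots,X]\!]_{\beta_1\ldots\beta_k} = \sum_{\alpha_1,\ldots,\alpha_k=1}^m c_{\alpha_1\ldots\alpha_k}\, x_{\beta_1\alpha_1}\cdots x_{\beta_k\alpha_k}.$$ The stabilizer of $C$ under congruence is $\{Z \in \mathrm{GL}(m,\mathbb{K}) : [\![C;Z,\ldots,Z]\!] = C\}$; it is called trivial if it equals $\{\eta I : \eta\in\mathbb{K},\ \eta^k=1\}$. Recovering $X$ up to scale means that every $Y\in\mathbb{K}^{d\times m}$ with $[\![C;Y,\ldots,Y]\!]=[\![C;X,\ldots,X]\!]$ is a scalar multiple of $X$.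
   Formalization: Over a finite field K the tensor C is additionally assumed nonzero: for K = F_2, m = 1, d = 2, C = 0 the stabilizer is trivial, but X = (1,0)^T and Y = (0,1)^T have the same tensor and are not proportional. For infinite K nothing is added. *)

theory Defs
  imports "HOL-Analysis.Analysis"
begin

text \<open>
  An element of \<open>(K\<^sup>m)\<^sup>\<otimes>\<^sup>k\<close> is represented by its array of entries: the index
  \<open>\<alpha> = (\<alpha>\<^sub>1, ..., \<alpha>\<^sub>k)\<close> is itself a vector of type \<open>'m ^ 'k\<close>, where \<open>m = CARD('m)\<close> and
  \<open>k = CARD('k)\<close>.  Under this representation the zero tensor is \<open>0\<close>.
\<close>

type_synonym ('a, 'm, 'k) tensor = "('a, ('m, 'k) vec) vec"

definition congruence_action ::
  "('a::field, 'm::finite, 'k::finite) tensor \<Rightarrow> 'a ^ 'm ^ 'd \<Rightarrow> ('a, 'd::finite, 'k) tensor"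
  where "congruence_action C X = (\<chi> \<beta>. \<Sum>\<alpha>\<in>UNIV. C $ \<alpha> * (\<Prod>j\<in>UNIV. X $ (\<beta> $ j) $ (\<alpha> $ j)))"

definition congruence_stabilizer ::
  "('a::field, 'm::finite, 'k::finite) tensor \<Rightarrow> ('a ^ 'm ^ 'm) set"
  where "congruence_stabilizer C = {Z. invertible Z \<and> congruence_action C Z = C}"

definition trivial_stabilizer :: "('a::field, 'm::finite, 'k::finite) tensor \<Rightarrow> bool"
  where "trivial_stabilizer C \<longleftrightarrow> congruence_stabilizer C = {mat \<eta> | \<eta>. \<eta> ^ CARD('k) = 1}"

text \<open>
  Over a finite field with \<open>q\<close> elements the zero tensor has trivial stabilizer when \<open>m = 1\<close> and
  \<open>q - 1\<close> divides \<open>k\<close>, since then every unit is a \<open>k\<close>-th root of unity; but nothing can be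
  recovered from the zero tensor if \<open>d \<ge> 2\<close>.  A recovery statement therefore has to exclude
  \<open>C = 0\<close> over finite fields; over an infinite field trivial stabilizer already implies \<open>C \<noteq> 0\<close>.
\<close>

definition recoverable_up_to_scale ::
  "('a::field, 'm::finite, 'k::finite) tensor \<Rightarrow> 'a ^ 'm ^ 'd::finite \<Rightarrow> bool"
  where "recoverable_up_to_scale C X \<longleftrightarrow>
    (\<forall>Y :: 'a ^ 'm ^ 'd. congruence_action C Y = congruence_action C X \<longrightarrow>
      (\<exists>c. Y = (\<chi> i j. c * X $ i $ j)))"

end

theory Submission
  imports Defs
begin

text \<open>
  Trivial stabilizer makes \<open>C\<close> concise: a functional \<open>\<phi> \<noteq> 0\<close> whose contraction with every slot of
  \<open>C\<close> vanishes gives matrices \<open>I + w \<phi>\<close> fixing \<open>C\<close>, and some of them are invertible and not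
  scalar.  Hence any \<open>Z\<close> with \<open>[C; Z, ..., Z] = C\<close> is invertible (otherwise take \<open>\<phi> Z = 0\<close>), so
  scalar.  If \<open>L X = I\<close> and \<open>[C; Y, ..., Y] = [C; X, ..., X]\<close>, applying \<open>L\<close> yields \<open>L Y = \<eta> I\<close>.  Every
  row vector \<open>n\<close> with \<open>n X = 0\<close> contracts the common tensor to zero in each slot; applying
  \<open>\<eta>\<^sup>-\<^sup>1 L\<close> in the other slots shows that \<open>n Y\<close> contracts \<open>C\<close> to zero, so \<open>n Y = 0\<close>.
  With \<open>n\<close> the rows of \<open>I - X L\<close> this reads \<open>Y = X L Y = \<eta> X\<close>.
\<close>

section \<open>Matrices acting on a tensor slot by slot\<close>

text \<open>A separate matrix per slot makes it possible to alter a single slot by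
  \<open>F(j := A)\<close>.\<close>

definition multilinear_action ::
  "('a::field, 'm::finite, 'k::finite) tensor \<Rightarrow> ('k \<Rightarrow> 'a ^ 'm ^ 'd) \<Rightarrow> ('a, 'd::finite, 'k) tensor"
  where "multilinear_action C F = (\<chi> \<beta>. \<Sum>\<alpha>\<in>UNIV. C $ \<alpha> * (\<Prod>j\<in>UNIV. F j $ (\<beta> $ j) $ (\<alpha> $ j)))"

text \<open>
  Says that contracting any slot of \<open>C\<close> with any row of \<open>A\<close> gives zero.  Square matrices stand in for
  single functionals so that all tensors keep the same shape.
\<close>

definition annihilates ::
  "'a ^ 'm ^ 'm \<Rightarrow> ('a::field, 'm::finite, 'k::finite) tensor \<Rightarrow> bool"
  where "annihilates A C \<longleftrightarrow> (\<forall>j. multilinear_action C ((\<lambda>_. mat 1)(j := A)) = 0)"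

lemma congruence_action_eq_multilinear_action:
  "congruence_action C X = multilinear_action C (\<lambda>_. X)"
  by (simp add: congruence_action_def multilinear_action_def)

lemma sum_prod_vec_nth:
  fixes f :: "'k::finite \<Rightarrow> 'n::finite \<Rightarrow> 'a::comm_semiring_1"
  shows "(\<Sum>\<beta>\<in>(UNIV :: ('n ^ 'k) set). \<Prod>j\<in>UNIV. f j (\<beta> $ j)) = (\<Prod>j\<in>UNIV. \<Sum>b\<in>UNIV. f j b)"
proof -
  have "(\<Sum>\<beta>\<in>(UNIV :: ('n ^ 'k) set). \<Prod>j\<in>UNIV. f j (\<beta> $ j)) = (\<Sum>g\<in>UNIV. \<Prod>j\<in>UNIV. f j (g j))"
    by (rule sum.reindex_bij_witness[of _ vec_lambda vec_nth]) auto
  also have "\<dots> = (\<Prod>j\<in>UNIV. \<Sum>b\<in>UNIV. f j b)"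
    by (subst prod_sum_PiE) auto
  finally show ?thesis .
qed

text \<open>Functoriality of tensor products of linear maps: once the sums are swapped, the sum over
  the intermediate multi-index factors into one matrix product per slot.\<close>

lemma multilinear_action_comp:
  "multilinear_action (multilinear_action C F) G = multilinear_action C (\<lambda>j. G j ** F j)"
proof -
  have "(\<Sum>\<beta>\<in>UNIV. (\<Sum>\<alpha>\<in>UNIV. C $ \<alpha> * (\<Prod>j\<in>UNIV. F j $ (\<beta> $ j) $ (\<alpha> $ j))) *
          (\<Prod>j\<in>UNIV. G j $ (\<gamma> $ j) $ (\<beta> $ j)))
      = (\<Sum>\<alpha>\<in>UNIV. C $ \<alpha> * (\<Prod>j\<in>UNIV. (G j ** F j) $ (\<gamma> $ j) $ (\<alpha> $ j)))" for \<gamma>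
  proof -
    have "(\<Sum>\<beta>\<in>UNIV. (\<Sum>\<alpha>\<in>UNIV. C $ \<alpha> * (\<Prod>j\<in>UNIV. F j $ (\<beta> $ j) $ (\<alpha> $ j))) *
          (\<Prod>j\<in>UNIV. G j $ (\<gamma> $ j) $ (\<beta> $ j)))
      = (\<Sum>\<beta>\<in>UNIV. \<Sum>\<alpha>\<in>UNIV. C $ \<alpha> * (\<Prod>j\<in>UNIV. G j $ (\<gamma> $ j) $ (\<beta> $ j) * F j $ (\<beta> $ j) $ (\<alpha> $ j)))"
      by (simp only: sum_distrib_right prod.distrib mult.assoc)
        (intro sum.cong refl, simp only: mult.commute)
    also have "\<dots> = (\<Sum>\<alpha>\<in>UNIV. C $ \<alpha> *
        (\<Sum>\<beta>\<in>UNIV. \<Prod>j\<in>UNIV. G j $ (\<gamma> $ j) $ (\<beta> $ j) * F j $ (\<beta> $ j) $ (\<alpha> $ j)))"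
      by (subst sum.swap) (simp add: sum_distrib_left)
    also have "\<dots> = (\<Sum>\<alpha>\<in>UNIV. C $ \<alpha> * (\<Prod>j\<in>UNIV. (G j ** F j) $ (\<gamma> $ j) $ (\<alpha> $ j)))"
      by (simp add: sum_prod_vec_nth[of "\<lambda>j b. G j $ (\<gamma> $ j) $ b * F j $ b $ (_ $ j)"]
          matrix_matrix_mult_def)
    finally show ?thesis .
  qed
  then show ?thesis
    by (simp add: multilinear_action_def vec_eq_iff)
qed

lemma prod_if_vec_eq:
  fixes \<alpha> \<beta> :: "'n::finite ^ 'k::finite"
  shows "(\<Prod>j\<in>UNIV. if \<beta> $ j = \<alpha> $ j then 1 else (0::'a::field)) = (if \<alpha> = \<beta> then 1 else 0)"
proof (cases "\<alpha> = \<beta>")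
  case False
  then obtain j where "\<beta> $ j \<noteq> \<alpha> $ j"
    by (metis vec_eq_iff)
  then have "(\<Prod>j\<in>UNIV. if \<beta> $ j = \<alpha> $ j then 1 else (0::'a)) = 0"
    by (intro prod_zero) (auto intro!: bexI[of _ j])
  with False show ?thesis by simp
qed simp

lemma multilinear_action_id: "multilinear_action C (\<lambda>_. mat 1) = C"
  by (simp add: multilinear_action_def mat_def prod_if_vec_eq if_distrib[of "\<lambda>x. _ * x"] cong: if_cong)

lemma multilinear_action_upd_add:
  "multilinear_action C (F(j := A + B)) = multilinear_action C (F(j := A)) + multilinear_action C (F(j := B))"
proof -
  have *: "(\<Prod>i\<in>UNIV. (F(j := M)) i $ (\<beta> $ i) $ (\<alpha> $ i))
      = M $ (\<beta> $ j) $ (\<alpha> $ j) * (\<Prod>i\<in>UNIV - {j}. F i $ (\<beta> $ i) $ (\<alpha> $ i))" for M \<alpha> \<beta>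
    by (subst prod.remove[of _ j]) (auto intro!: prod.cong)
  show ?thesis
    by (simp add: multilinear_action_def * vec_eq_iff algebra_simps sum.distrib del: fun_upd_apply)
qed

lemma multilinear_action_zero_tensor [simp]: "multilinear_action 0 F = 0"
  by (simp add: multilinear_action_def vec_eq_iff)

lemma multilinear_action_zero_slot:
  assumes "F j = 0"
  shows "multilinear_action C F = 0"
proof -
  have "(\<Prod>i\<in>UNIV. F i $ (\<beta> $ i) $ (\<alpha> $ i)) = 0" for \<alpha> \<beta>
    by (rule prod_zero, simp, rule bexI[of _ j]) (simp_all add: assms)
  then show ?thesis by (simp only: multilinear_action_def vec_eq_iff) simp
qed

section \<open>Vanishing contractions and the matrices that fix a tensor\<close>

lemma annihilates_mult_left:
  assumes "annihilates A C"
  shows "annihilates (W ** A) C"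
  unfolding annihilates_def
proof
  fix j
  have "multilinear_action (multilinear_action C ((\<lambda>_. mat 1)(j := A))) ((\<lambda>_. mat 1)(j := W))
      = multilinear_action C ((\<lambda>_. mat 1)(j := W ** A))"
    unfolding multilinear_action_comp by (rule arg_cong[of _ _ "multilinear_action C"]) auto
  then show "multilinear_action C ((\<lambda>_. mat 1)(j := W ** A)) = 0"
    using assms by (simp add: annihilates_def)
qed

text \<open>The factors \<open>mat 1 + A\<close> are inserted one slot at a time; each insertion fixes \<open>C\<close>.\<close>

lemma annihilates_imp_fixes:
  assumes "annihilates A C"
  shows "congruence_action C (mat 1 + A) = C"
proof -
  have slot: "multilinear_action C ((\<lambda>_. mat 1)(j := mat 1 + A)) = C" for j
  proof -
    have "multilinear_action C ((\<lambda>_. mat 1)(j := mat 1)) = C"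
      by (simp add: fun_upd_idem multilinear_action_id)
    then show ?thesis
      using assms by (simp only: multilinear_action_upd_add annihilates_def add_0_right)
  qed
  have "multilinear_action C (\<lambda>j. if j \<in> S then mat 1 + A else mat 1) = C" if "finite S" for S
    using that
  proof induction
    case empty
    then show ?case by (simp add: multilinear_action_id)
  next
    case (insert j S)
    have "multilinear_action (multilinear_action C (\<lambda>j. if j \<in> S then mat 1 + A else mat 1))
          ((\<lambda>_. mat 1)(j := mat 1 + A))
        = multilinear_action C (\<lambda>i. if i \<in> insert j S then mat 1 + A else mat 1)"
      unfolding multilinear_action_comp
      by (rule arg_cong[of _ _ "multilinear_action C"]) (use insert.hyps in \<open>auto simp: fun_eq_iff\<close>)
    then show ?case
      using insert.IH slot by simp
  qed
  from this[of UNIV] show ?thesis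
    by (simp add: congruence_action_eq_multilinear_action)
qed

lemma matrix_add_rdistrib: "(A + B) ** C = A ** C + B ** C"
  by (simp add: matrix_matrix_mult_def vec_eq_iff distrib_right sum.distrib)

lemma matrix_diff_ldistrib: "A ** (B - C) = A ** B - A ** C"
  for A :: "'a::ring_1 ^ 'n ^ 'm"
  by (simp add: matrix_matrix_mult_def vec_eq_iff right_diff_distrib sum_subtractf)

lemma matrix_diff_rdistrib: "(A - B) ** C = A ** C - B ** C"
  for A :: "'a::ring_1 ^ 'n ^ 'm"
  by (simp add: matrix_matrix_mult_def vec_eq_iff left_diff_distrib sum_subtractf)

lemma invertible_mat:
  fixes \<eta> :: "'a::field"
  assumes "\<eta> \<noteq> 0"
  shows "invertible (mat \<eta> :: 'a ^ 'n::finite ^ 'n)"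
  unfolding invertible_def
  by (rule exI[of _ "mat (inverse \<eta>)"])
    (use assms in \<open>auto simp: matrix_matrix_mult_def mat_def vec_eq_iff
      if_distrib[of "\<lambda>x. x * _"] if_distrib[of "\<lambda>x. _ * x"] cong: if_cong\<close>)

section \<open>Consequences of a trivial stabilizer\<close>

text \<open>If \<open>C = 0\<close>, every nonzero scalar matrix lies in the stabilizer, so every
  nonzero field element is a root of x^k - 1 and the field is finite.\<close>

lemma trivial_stabilizer_nonzero:
  fixes C :: "('a::field, 'm::finite, 'k::finite) tensor"
  assumes triv: "trivial_stabilizer C" and "infinite (UNIV :: 'a set) \<or> C \<noteq> 0"
  shows "C \<noteq> 0"
proof
  assume "C = 0"
  have root: "\<eta> ^ CARD('k) = 1" if "\<eta> \<noteq> 0" for \<eta> :: 'a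
  proof -
    have "(mat \<eta> :: 'a ^ 'm ^ 'm) \<in> congruence_stabilizer C"
      using that \<open>C = 0\<close>
      by (simp add: congruence_stabilizer_def invertible_mat congruence_action_eq_multilinear_action)
    then obtain \<eta>' where "(mat \<eta> :: 'a ^ 'm ^ 'm) = mat \<eta>'" "\<eta>' ^ CARD('k) = 1"
      using triv by (auto simp: trivial_stabilizer_def)
    then show ?thesis by (simp add: mat_def vec_eq_iff) metis
  qed
  let ?p = "monom 1 (CARD('k)) - [:1:] :: 'a poly"
  \<comment> \<open>\<open>CARD('k)\<close> is positive, so the subtracted constant does not touch
    the leading coefficient.\<close>
  have "coeff ?p (CARD('k)) = 1"
    by (simp add: coeff_pCons split: nat.split)
  then have "?p \<noteq> 0" by (metis coeff_0 zero_neq_one)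
  then have "finite {x. poly ?p x = 0}" by (rule poly_roots_finite)
  moreover have "UNIV \<subseteq> insert 0 {x. poly ?p x = 0}"
    using root by (auto simp: poly_monom)
  ultimately have "finite (UNIV :: 'a set)"
    by (meson finite_insert finite_subset)
  with assms(2) \<open>C = 0\<close> show False by simp
qed

text \<open>If \<open>N = W ** A\<close> squares to zero, 1 - N inverts 1 + N. The second index
  \<open>s\<close> provides an off-diagonal entry that rules out scalar matrices.\<close>

lemma exists_nonscalar_invertible_one_plus:
  fixes A :: "'a::field ^ 'm::finite ^ 'm"
  assumes entry: "A $ p $ q \<noteq> 0" and "s \<noteq> q"
  obtains W where "invertible (mat 1 + W ** A)" "\<And>\<eta>. mat 1 + W ** A \<noteq> mat \<eta>"
proof
  \<comment> \<open>\<open>w\<close> lies in the kernel of row \<open>p\<close> of \<open>A\<close>, so \<open>W ** A\<close> squares to zero.\<close>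
  define w where "w i = (if i = q then A $ p $ s else if i = s then - A $ p $ q else 0)" for i
  define W :: "'a ^ 'm ^ 'm" where "W = (\<chi> i j. if j = p then w i else 0)"
  \<comment> \<open>\<open>W ** A\<close> is the outer product of \<open>w\<close> with row
    \<open>p\<close> of \<open>A\<close>, so its square contains their dot product as a
    factor.\<close>
  have WA: "(W ** A) $ i $ j = w i * A $ p $ j" for i j
    by (simp add: W_def matrix_matrix_mult_def if_distrib[of "\<lambda>x. x * _"] cong: if_cong)
  have "(\<Sum>k\<in>UNIV. A $ p $ k * w k) = (\<Sum>k\<in>{q, s}. A $ p $ k * w k)"
    by (rule sum.mono_neutral_right) (auto simp: w_def)
  also have "\<dots> = 0"
    using \<open>s \<noteq> q\<close> by (simp add: w_def)
  finally have "(\<Sum>k\<in>UNIV. A $ p $ k * w k) = 0" .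
  then have "(\<Sum>k\<in>UNIV. (W ** A) $ i $ k * (W ** A) $ k $ j) = 0" for i j
    by (simp add: WA mult.assoc mult.left_commute[of _ "A $ p $ j"] flip: sum_distrib_left)
      (metis (no_types, lifting) mult.assoc mult_zero_left sum.cong sum_distrib_right)
  then have sq: "(W ** A) ** (W ** A) = 0"
    by (simp add: vec_eq_iff matrix_matrix_mult_def[of "W ** A" "W ** A"])
  have "(mat 1 + W ** A) ** (mat 1 - W ** A) = mat 1" "(mat 1 - W ** A) ** (mat 1 + W ** A) = mat 1"
    using sq by (simp_all add: matrix_add_ldistrib matrix_add_rdistrib matrix_diff_ldistrib matrix_diff_rdistrib)
  then show "invertible (mat 1 + W ** A)"
    unfolding invertible_def by blast
  fix \<eta>
  \<comment> \<open>The entry equals -(\<open>A $ p $ q\<close>)^2.\<close>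
  have "(mat 1 + W ** A) $ s $ q \<noteq> 0"
    using entry \<open>s \<noteq> q\<close> by (simp add: WA w_def mat_def)
  moreover have "(mat \<eta> :: 'a ^ 'm ^ 'm) $ s $ q = 0"
    using \<open>s \<noteq> q\<close> by (simp add: mat_def)
  ultimately show "mat 1 + W ** A \<noteq> mat \<eta>"
    by fastforce
qed

text \<open>For m >= 2 a nonzero \<open>A\<close> yields a non-scalar stabilizer element. For m = 1
  all matrices are scalar, and the contradiction is with \<open>C \<noteq> 0\<close>
  instead.\<close>

lemma annihilates_trivial_stabilizer:
  fixes C :: "('a::field, 'm::finite, 'k::finite) tensor"
  assumes triv: "trivial_stabilizer C" and "C \<noteq> 0" and ann: "annihilates A C"
  shows "A = 0"
proof (rule ccontr)
  assume "A \<noteq> 0"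
  then obtain p q where pq: "A $ p $ q \<noteq> 0"
    by (auto simp: vec_eq_iff)
  show False
  proof (cases "\<exists>s. s \<noteq> q")
    case True
    then obtain s where "s \<noteq> q" by blast
    with pq obtain W where W: "invertible (mat 1 + W ** A)" "\<And>\<eta>. mat 1 + W ** A \<noteq> mat \<eta>"
      using exists_nonscalar_invertible_one_plus by blast
    have "mat 1 + W ** A \<in> congruence_stabilizer C"
      using W(1) annihilates_imp_fixes[OF annihilates_mult_left[OF ann]]
      by (simp add: congruence_stabilizer_def)
    with triv W(2) show False
      by (auto simp: trivial_stabilizer_def)
  next
    case False
    \<comment> \<open>Now m = 1, so \<open>A\<close> is invertible and can be normalised to the
      identity, whose contraction returns \<open>C\<close> itself.\<close>
    then have eq: "i = q" for i by blast
    have "A = mat (A $ q $ q)"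
      by (simp add: vec_eq_iff mat_def) (metis eq)
    moreover have "A $ q $ q \<noteq> 0"
      using pq eq by metis
    ultimately have "invertible A" by (metis invertible_mat)
    then obtain B where "B ** A = mat 1"
      by (auto simp: invertible_def)
    then have "annihilates (mat 1) C"
      using annihilates_mult_left[OF ann] by metis
    then have "C = 0"
      by (simp add: annihilates_def multilinear_action_id fun_upd_idem)
    with \<open>C \<noteq> 0\<close> show False by simp
  qed
qed

text \<open>Row rank equals column rank, so the rows of \<open>X\<close> span the whole space and
  combine to the rows of the identity.\<close>

lemma full_column_rank_left_inverse:
  fixes X :: "'a::field ^ 'm::finite ^ 'd::finite"
  assumes "rank X = CARD('m)"
  obtains L where "L ** X = mat 1"
proof -
  have "vec.dim (rows X) = vec.dimension TYPE('a) TYPE('m)"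
    using assms by (simp add: row_rank_def_gen vec.dimension_def card_cart_basis)
  then have "vec.span (rows X) = UNIV"
    by (simp add: vec.dim_eq_full)
  then show thesis
    using that by (auto simp flip: matrix_left_invertible_span_rows_gen)
qed

lemma not_invertible_left_annihilator:
  fixes Z :: "'a::field ^ 'm::finite ^ 'm"
  assumes "\<not> invertible Z"
  obtains A :: "'a ^ 'm ^ 'm" where "A \<noteq> 0" "A ** Z = 0"
proof -
  have "\<nexists>B. B ** transpose Z = mat 1"
    using assms by (metis invertible_right_inverse left_invertible_transpose)
  then obtain x where x: "transpose Z *v x = 0" "x \<noteq> 0"
    unfolding matrix_left_invertible_ker by blast
  show thesis
  proof
    \<comment> \<open>The left null vector \<open>x\<close> is repeated in every row to obtain the
      square shape that \<open>annihilates\<close> takes.\<close>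
    show "(\<chi> i. x) \<noteq> (0 :: 'a ^ 'm ^ 'm)"
      using x(2) by (simp add: vec_eq_iff)
    show "(\<chi> i. x) ** Z = (0 :: 'a ^ 'm ^ 'm)"
      using x(1) by (simp add: vec_eq_iff matrix_matrix_mult_def matrix_vector_mult_def transpose_def mult.commute)
  qed
qed

text \<open>The stabilizer consists of invertible matrices, so invertibility comes first: if
  \<open>A ** Z = 0\<close>, then \<open>A\<close> contracts \<open>C\<close>, being its own image
  under \<open>Z\<close>, to zero in each slot.\<close>

lemma fixes_trivial_stabilizer:
  fixes C :: "('a::field, 'm::finite, 'k::finite) tensor"
  assumes triv: "trivial_stabilizer C" and "C \<noteq> 0" and fixed: "congruence_action C Z = C"
  obtains \<eta> where "Z = mat \<eta>" "\<eta> \<noteq> 0"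
proof -
  have "invertible Z"
  proof (rule ccontr)
    assume "\<not> invertible Z"
    then obtain A :: "'a ^ 'm ^ 'm" where A: "A \<noteq> 0" "A ** Z = 0"
      by (rule not_invertible_left_annihilator)
    have "annihilates A C"
      unfolding annihilates_def
    proof
      fix j
      have "multilinear_action (congruence_action C Z) ((\<lambda>_. mat 1)(j := A)) = 0"
        unfolding congruence_action_eq_multilinear_action multilinear_action_comp
        by (rule multilinear_action_zero_slot[of _ j]) (simp add: A)
      then show "multilinear_action C ((\<lambda>_. mat 1)(j := A)) = 0"
        by (simp only: fixed)
    qed
    with triv \<open>C \<noteq> 0\<close> A(1) show False
      using annihilates_trivial_stabilizer by blast
  qed
  then have "Z \<in> congruence_stabilizer C"
    using fixed by (simp add: congruence_stabilizer_def)
  then obtain \<eta> where "Z = mat \<eta>" "\<eta> ^ CARD('k) = 1"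
    using triv by (auto simp: trivial_stabilizer_def)
  \<comment> \<open>\<open>\<eta>\<close> is nonzero because a positive power of 0 is 0.\<close>
  with that show thesis
    by (metis power_0_left zero_less_card_finite less_numeral_extra(3) zero_neq_one)
qed

section \<open>Recovery of the matrix\<close>

theorem corollary4p4:
  fixes C :: "('a::field, 'm::finite, 'k::finite) tensor"
    and X :: "'a ^ 'm ^ 'd::finite"
  assumes "trivial_stabilizer C"
    and "infinite (UNIV :: 'a set) \<or> C \<noteq> 0"
    and "rank X = CARD('m)"
  shows "recoverable_up_to_scale C X"
  unfolding recoverable_up_to_scale_def
proof (intro allI impI)
  fix Y :: "'a ^ 'm ^ 'd"
  assume same: "congruence_action C Y = congruence_action C X"
  have "C \<noteq> 0"
    using assms by (blast dest: trivial_stabilizer_nonzero)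
  obtain L where L: "L ** X = mat 1"
    using assms(3) by (rule full_column_rank_left_inverse)
  have "congruence_action C (L ** Y) = multilinear_action (congruence_action C Y) (\<lambda>_. L)"
    by (simp add: congruence_action_eq_multilinear_action multilinear_action_comp)
  also have "\<dots> = C"
    by (simp only: same)
      (simp add: congruence_action_eq_multilinear_action multilinear_action_comp L multilinear_action_id)
  finally obtain \<eta> where \<eta>: "L ** Y = mat \<eta>" "\<eta> \<noteq> 0"
    using fixes_trivial_stabilizer assms(1) \<open>C \<noteq> 0\<close> by blast
  \<comment> \<open>A left inverse of \<open>Y\<close>: placed in a slot, it undoes \<open>Y\<close>
    there.\<close>
  define L' where "L' = mat (inverse \<eta>) ** L"
  have L': "L' ** Y = mat 1"
    using \<eta> by (simp add: L'_def flip: matrix_mul_assoc)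
      (simp add: matrix_matrix_mult_def mat_def vec_eq_iff if_distrib[of "\<lambda>x. _ * x"] cong: if_cong)
  have vanish: "N ** Y = 0" if "N ** X = 0" for N :: "'a ^ 'd ^ 'm"
  proof -
    have "annihilates (N ** Y) C"
      unfolding annihilates_def
    proof
      fix j
      \<comment> \<open>Applied to the image under \<open>Y\<close>, \<open>L'\<close> restores the
        identity in all slots but \<open>j\<close>, which holds \<open>N ** Y\<close>. Applied to
        the same tensor as the image under \<open>X\<close>, slot \<open>j\<close> holds
        \<open>N ** X = 0\<close>.\<close>
      have "multilinear_action C ((\<lambda>_. mat 1)(j := N ** Y))
          = multilinear_action (congruence_action C Y) ((\<lambda>_. L')(j := N))"
        unfolding congruence_action_eq_multilinear_action multilinear_action_comp
        by (rule arg_cong[of _ _ "multilinear_action C"]) (auto simp: L')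
      also have "\<dots> = multilinear_action (congruence_action C X) ((\<lambda>_. L')(j := N))"
        by (simp only: same)
      also have "\<dots> = 0"
        unfolding congruence_action_eq_multilinear_action multilinear_action_comp
        by (rule multilinear_action_zero_slot[of _ j]) (simp add: that)
      finally show "multilinear_action C ((\<lambda>_. mat 1)(j := N ** Y)) = 0" .
    qed
    with assms(1) \<open>C \<noteq> 0\<close> show ?thesis
      by (rule annihilates_trivial_stabilizer)
  qed
  \<comment> \<open>The projection whose kernel is the column space of \<open>X\<close>.\<close>
  define P where "P = mat 1 - X ** L"
  have "P ** X = 0"
    by (simp add: P_def matrix_diff_rdistrib L flip: matrix_mul_assoc)
  have "(P ** Y) $ i = 0" for i
  proof -
    \<comment> \<open>\<open>vanish\<close> takes matrices with m rows, while \<open>P\<close> has d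
      rows; hence one row of \<open>P\<close> at a time is repeated m times.\<close>
    have row: "((\<chi> a. P $ i) ** M) $ a = (P ** M) $ i" for M :: "'a ^ 'm ^ 'd" and a :: 'm
      by (simp add: matrix_matrix_mult_def vec_eq_iff)
    have "(\<chi> (a::'m). P $ i) ** X = 0"
      by (subst vec_eq_iff) (simp add: row \<open>P ** X = 0\<close>)
    then show ?thesis
      using vanish row by (metis zero_index)
  qed
  then have "P ** Y = 0"
    by (simp add: vec_eq_iff)
  then have "Y = X ** mat \<eta>"
    by (simp add: P_def matrix_diff_rdistrib \<eta> flip: matrix_mul_assoc)
  also have "\<dots> = (\<chi> i j. \<eta> * X $ i $ j)"
    by (simp add: matrix_matrix_mult_def mat_def vec_eq_iff if_distrib[of "\<lambda>x. _ * x"] mult.commute cong: if_cong)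
  finally show "\<exists>c. Y = (\<chi> i j. c * X $ i $ j)" by blast
qed

end
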